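(* Let $(S,A,r,P,\mu_0,H)$ be a finite-horizon mean-field game satisfying Assumptions 1 (weak monotonicity), 2 (transition kernel independent of the state measure) and 3 (Lipschitz reward) stated in the context. Let $\pi^*=(\pi^*_h)_{h=0}^{H-1}$ be a policy flow and $\mu^*=(\mu^*_h)_{h=0}^{H-1}$ a state-measure flow (with $\mu^*_0=\mu_0$), and define $\rho^*_h(s,a)=\pi^*_h(a\mid s)\,\mu^*_h(s)$. Then $(\pi^*,\mu^* )$ is a mean-field equilibrium if and only if $\rho^*\in\mathcal K$ and $$\mathbf 0\in F(\rho^* )+N_{\mathcal K}(\rho^* ).$$
   Context: Mean-field game: $S$ and $A$ are finite nonempty sets, $H\ge 1$ an integer, $\mathcal P(S)$ the set of probability measures on $S$, $\mu_0\in\mathcal P(S)$, $r:S\times A\times\mathcal P(S)\to\mathbb R$ the reward, $P:S\times A\times\mathcal P(S)\to\mathcal P(S)$ the transition kernel. A policy flow is $\pi=(\pi_h)_{h=0}^{H-1}$ with $\pi_h(\cdot\mid s)\in\mathcal P(A)$ for each $s\in S$. A state-measure flow is $\mu=(\mu_h)_{h=0}^{H-1}$ with $\mu_h\in\mathcal P(S)$, whose first entry is always the given $\mu_0$. Objective: $J(\pi,\mu)=\mathbb E\big[\sum_{h=0}^{H-1} r(x_h,a_h,\mu_h)\big]$, where $x_0\sim\mu_0$, $a_h\sim\pi_h(\cdot\mid x_h)$, $x_{h+1}\sim P(\cdot\mid x_h,a_h,\mu_h)$. A pair $(\pi^*,\mu^* )$ is a mean-field equilibrium (MFE) if $J(\pi,\mu^*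 )\le J(\pi^*,\mu^* )$ for every policy flow $\pi$, and $\mu^*_{h+1}(\cdot)=\sum_{s\in S}\sum_{a\in A}P(\cdot\mid s,a,\mu^*_h)\pi^*_h(a\mid s)\mu^*_h(s)$ for $h=0,\dots,H-2$. Assumption 2: $P(\cdot\mid s,a,\mu)=P(\cdot\mid s,a)$ for all $\mu\in\mathcal P(S)$. Given a policy flow $\pi$, its state flow is $\mu^\pi_0=\mu_0$, $\mu^\pi_{h+1}(s')=\sum_{s,a}P(s'\mid s,a)\pi_h(a\mid s)\mu^\pi_h(s)$, and its occupation flow is $\rho^\pi_h(s,a)=\pi_h(a\mid s)\mu^\pi_h(s)$. Assumption 1 (weak monotonicity): for all policy flows $\pi,\tilde\pi$, $\sum_{h=0}^{H-1}\sum_{s,a}\big(r(s,a,\mu^\pi_h)-r(s,a,\mu^{\tilde\pi}_h)\big)\big(\rho^\pi_h(s,a)-\rho^{\tilde\pi}_h(s,a)\big)\le 0$. Assumption 3: $|r(s,a,\mu)-r(s,a,\tilde\mu)|\le L_r\|\mu-\tilde\mu\|_{\mathrm{TV}}$ for all $(s,a)$ and $\mu,\tilde\mu\in\mathcal P(S)$, where $\|\mu-\tilde\mu\|_{\mathrm{TV}}=\sum_{s}|\mu(s)-\tilde\mu(s)|$. Occupation-flow polytope: $\mathcal K$ is the set of $\rho=(\rho_h)_{h=0}^{H-1}\in\prod_{h=0}^{H-1}\mathbb R_+^{S\times A}$ with $\sum_a\rho_0(s,a)=\mu_0(s)$ for all $s$, and $\sum_a\rho_{h+1}(s',a)=\sum_{s,a}P(s'\mid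 s,a)\rho_h(s,a)$ for all $s'\in S$, $h=0,\dots,H-2$. For $\rho\in\mathcal K$ put $\mu^\rho_h(s)=\sum_a\rho_h(s,a)$. The mean-field occupation operator $F:\mathcal K\to\mathbb R^{H|S||A|}$ is $[F(\rho)]_{h,s,a}=-r(s,a,\mu^\rho_h)$. The normal cone operator is $N_{\mathcal K}(x)=\{g\in\mathbb R^{H|S||A|}:\langle g,y-x\rangle\le 0\ \forall y\in\mathcal K\}$ for $x\in\mathcal K$ and $N_{\mathcal K}(x)=\varnothing$ for $x\notin\mathcal K$. *)

theory Defs
  imports
    "HOL-Probability.Probability_Mass_Function"
    "HOL-Library.Function_Algebras"
    "HOL-Library.Set_Algebras"
begin

text \<open>
  The finite nonempty sets \<open>S\<close> and \<open>A\<close> are types of class \<open>finite\<close>, so that \<open>'s pmf\<close> is exactly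
  the set of probability measures on \<open>S\<close>.  Flows \<open>(f\<^sub>h)\<close> with \<open>0 \<le> h < H\<close> are functions on \<open>nat\<close>.
  Entries of policy flows and state-measure flows at indices \<open>h \<ge> H\<close> are irrelevant: the
  objective, the equilibrium and monotonicity conditions and \<open>occupation\<close> do not depend on them.
  Real vectors indexed by \<open>(h, s, a)\<close> are required to vanish for \<open>h \<ge> H\<close> (\<open>flow_space\<close>), so that
  vector equality and the set sum \<open>+o\<close> in the inclusion are the literal ones.
\<close>

type_synonym ('s, 'a) reward = "'s \<Rightarrow> 'a \<Rightarrow> 's pmf \<Rightarrow> real"
type_synonym ('s, 'a) mf_kernel = "'s \<Rightarrow> 'a \<Rightarrow> 's pmf \<Rightarrow> 's pmf"
type_synonym ('s, 'a) kernel = "'s \<Rightarrow> 'a \<Rightarrow> 's pmf"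
type_synonym ('s, 'a) policy_flow = "nat \<Rightarrow> 's \<Rightarrow> 'a pmf"
type_synonym 's measure_flow = "nat \<Rightarrow> 's pmf"
type_synonym ('s, 'a) flow = "nat \<Rightarrow> 's \<Rightarrow> 'a \<Rightarrow> real"

text \<open>
  The joint law of \<open>[(x\<^sub>0, a\<^sub>0), \<dots>, (x\<^sub>n, a\<^sub>n)]\<close> under the policy flow \<open>\<pi>\<close>,
  with the population frozen at \<open>\<mu>\<close>.
\<close>

primrec trajectory ::
  "('s, 'a) mf_kernel \<Rightarrow> 's pmf \<Rightarrow> ('s, 'a) policy_flow \<Rightarrow> 's measure_flow \<Rightarrow> nat \<Rightarrow> ('s \<times> 'a) list pmf"
where
  "trajectory P \<mu>0 \<pi> \<mu> 0 =
     bind_pmf \<mu>0 (\<lambda>x. bind_pmf (\<pi> 0 x) (\<lambda>a. return_pmf [(x, a)]))"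
| "trajectory P \<mu>0 \<pi> \<mu> (Suc n) =
     bind_pmf (trajectory P \<mu>0 \<pi> \<mu> n) (\<lambda>\<omega>.
       bind_pmf (P (fst (last \<omega>)) (snd (last \<omega>)) (\<mu> n)) (\<lambda>x.
         bind_pmf (\<pi> (Suc n) x) (\<lambda>a. return_pmf (\<omega> @ [(x, a)]))))"

definition objective ::
  "nat \<Rightarrow> ('s, 'a) reward \<Rightarrow> ('s, 'a) mf_kernel \<Rightarrow> 's pmf \<Rightarrow>
    ('s, 'a) policy_flow \<Rightarrow> 's measure_flow \<Rightarrow> real"
where
  "objective H r P \<mu>0 \<pi> \<mu> =
     measure_pmf.expectation (trajectory P \<mu>0 \<pi> \<mu> (H - 1))
       (\<lambda>\<omega>. \<Sum>h<H. r (fst (\<omega> ! h)) (snd (\<omega> ! h)) (\<mu> h))"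

definition mean_field_equilibrium ::
  "nat \<Rightarrow> ('s::finite, 'a::finite) reward \<Rightarrow> ('s, 'a) mf_kernel \<Rightarrow> 's pmf \<Rightarrow>
    ('s, 'a) policy_flow \<Rightarrow> 's measure_flow \<Rightarrow> bool"
where
  "mean_field_equilibrium H r P \<mu>0 \<pi>' \<mu>' \<longleftrightarrow>
     (\<forall>\<pi>. objective H r P \<mu>0 \<pi> \<mu>' \<le> objective H r P \<mu>0 \<pi>' \<mu>') \<and>
     (\<forall>h. Suc h < H \<longrightarrow> (\<forall>s'. pmf (\<mu>' (Suc h)) s' =
        (\<Sum>s\<in>UNIV. \<Sum>a\<in>UNIV. pmf (P s a (\<mu>' h)) s' * pmf (\<pi>' h s) a * pmf (\<mu>' h) s)))"

definition measure_independent ::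
  "('s, 'a) mf_kernel \<Rightarrow> ('s, 'a) kernel \<Rightarrow> bool"
where
  "measure_independent P P0 \<longleftrightarrow> (\<forall>s a \<mu>. P s a \<mu> = P0 s a)"

text \<open>The total variation norm carries no factor \<open>1/2\<close>.\<close>

definition tv_norm :: "'s::finite pmf \<Rightarrow> 's pmf \<Rightarrow> real" where
  "tv_norm \<mu> \<nu> = (\<Sum>s\<in>UNIV. \<bar>pmf \<mu> s - pmf \<nu> s\<bar>)"

definition lipschitz_reward :: "real \<Rightarrow> ('s::finite, 'a) reward \<Rightarrow> bool" where
  "lipschitz_reward L r \<longleftrightarrow> (\<forall>s a \<mu> \<nu>. \<bar>r s a \<mu> - r s a \<nu>\<bar> \<le> L * tv_norm \<mu> \<nu>)"

primrec state_flow ::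
  "('s, 'a) kernel \<Rightarrow> 's pmf \<Rightarrow> ('s, 'a) policy_flow \<Rightarrow> 's measure_flow"
where
  "state_flow P0 \<mu>0 \<pi> 0 = \<mu>0"
| "state_flow P0 \<mu>0 \<pi> (Suc h) =
     bind_pmf (state_flow P0 \<mu>0 \<pi> h) (\<lambda>s. bind_pmf (\<pi> h s) (\<lambda>a. P0 s a))"

lemma pmf_state_flow_Suc:
  fixes P0 :: "('s::finite, 'a::finite) kernel"
  shows "pmf (state_flow P0 \<mu>0 \<pi> (Suc h)) s' =
    (\<Sum>s\<in>UNIV. \<Sum>a\<in>UNIV. pmf (P0 s a) s' * pmf (\<pi> h s) a * pmf (state_flow P0 \<mu>0 \<pi> h) s)"
  by (simp add: pmf_bind integral_measure_pmf[of UNIV] sum_distrib_left mult_ac)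

definition occupation ::
  "nat \<Rightarrow> ('s, 'a) policy_flow \<Rightarrow> 's measure_flow \<Rightarrow> ('s, 'a) flow"
where
  "occupation H \<pi> \<mu> h s a = (if h < H then pmf (\<pi> h s) a * pmf (\<mu> h) s else 0)"

definition weakly_monotone ::
  "nat \<Rightarrow> ('s::finite, 'a::finite) reward \<Rightarrow> ('s, 'a) kernel \<Rightarrow> 's pmf \<Rightarrow> bool"
where
  "weakly_monotone H r P0 \<mu>0 \<longleftrightarrow>
     (\<forall>\<pi> \<pi>'. (\<Sum>h<H. \<Sum>s\<in>UNIV. \<Sum>a\<in>UNIV.
        (r s a (state_flow P0 \<mu>0 \<pi> h) - r s a (state_flow P0 \<mu>0 \<pi>' h)) *
        (occupation H \<pi> (state_flow P0 \<mu>0 \<pi>) h s a -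
         occupation H \<pi>' (state_flow P0 \<mu>0 \<pi>') h s a)) \<le> 0)"

definition flow_space :: "nat \<Rightarrow> ('s, 'a) flow set" where
  "flow_space H = {f. \<forall>h\<ge>H. \<forall>s a. f h s a = 0}"

definition flow_inner ::
  "nat \<Rightarrow> ('s::finite, 'a::finite) flow \<Rightarrow> ('s, 'a) flow \<Rightarrow> real"
where
  "flow_inner H f g = (\<Sum>h<H. \<Sum>s\<in>UNIV. \<Sum>a\<in>UNIV. f h s a * g h s a)"

definition occupation_polytope ::
  "nat \<Rightarrow> ('s::finite, 'a::finite) kernel \<Rightarrow> 's pmf \<Rightarrow> ('s, 'a) flow set"
where
  "occupation_polytope H P0 \<mu>0 =
     {\<rho> \<in> flow_space H.
        (\<forall>h<H. \<forall>s a. 0 \<le> \<rho> h s a) \<and>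
        (\<forall>s. (\<Sum>a\<in>UNIV. \<rho> 0 s a) = pmf \<mu>0 s) \<and>
        (\<forall>h. Suc h < H \<longrightarrow> (\<forall>s'. (\<Sum>a\<in>UNIV. \<rho> (Suc h) s' a) =
           (\<Sum>s\<in>UNIV. \<Sum>a\<in>UNIV. pmf (P0 s a) s' * \<rho> h s a)))}"

text \<open>
  The state marginal as a probability measure; meaningful only for \<open>\<rho>\<close> in the polytope and \<open>h < H\<close>,
  see \<open>pmf_marginal\<close>.
\<close>

definition marginal :: "('s, 'a::finite) flow \<Rightarrow> 's measure_flow" where
  "marginal \<rho> h = embed_pmf (\<lambda>s. \<Sum>a\<in>UNIV. \<rho> h s a)"

lemma occupation_polytope_total:
  fixes P0 :: "('s::finite, 'a::finite) kernel"
  assumes "\<rho> \<in> occupation_polytope H P0 \<mu>0" and "h < H"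
  shows "(\<Sum>s\<in>UNIV. \<Sum>a\<in>UNIV. \<rho> h s a) = 1"
  using \<open>h < H\<close>
proof (induction h)
  case 0
  then show ?case
    using assms(1) by (simp add: occupation_polytope_def sum_pmf_eq_1)
next
  case (Suc h)
  have "(\<Sum>s'\<in>UNIV. \<Sum>a\<in>UNIV. \<rho> (Suc h) s' a) =
      (\<Sum>s'\<in>UNIV. \<Sum>s\<in>UNIV. \<Sum>a\<in>UNIV. pmf (P0 s a) s' * \<rho> h s a)"
    using assms(1) Suc.prems by (simp add: occupation_polytope_def)
  also have "\<dots> = (\<Sum>s\<in>UNIV. \<Sum>s'\<in>UNIV. \<Sum>a\<in>UNIV. pmf (P0 s a) s' * \<rho> h s a)"
    by (rule sum.swap)
  also have "\<dots> = (\<Sum>s\<in>UNIV. \<Sum>a\<in>UNIV. \<Sum>s'\<in>UNIV. pmf (P0 s a) s' * \<rho> h s a)"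
    by (intro sum.cong refl sum.swap)
  also have "\<dots> = (\<Sum>s\<in>UNIV. \<Sum>a\<in>UNIV. \<rho> h s a)"
    by (simp add: sum_distrib_right[symmetric] sum_pmf_eq_1)
  finally show ?case
    using Suc by simp
qed

lemma pmf_marginal:
  fixes P0 :: "('s::finite, 'a::finite) kernel"
  assumes "\<rho> \<in> occupation_polytope H P0 \<mu>0" and "h < H"
  shows "pmf (marginal \<rho> h) s = (\<Sum>a\<in>UNIV. \<rho> h s a)"
proof -
  have nn: "0 \<le> (\<Sum>a\<in>UNIV. \<rho> h s a)" for s
    using assms by (intro sum_nonneg) (simp add: occupation_polytope_def)
  have "(\<integral>\<^sup>+ s. ennreal (\<Sum>a\<in>UNIV. \<rho> h s a) \<partial>count_space UNIV) = 1"
    using nn occupation_polytope_total[OF assms]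
    by (simp add: nn_integral_count_space_finite sum_ennreal)
  then show ?thesis
    unfolding marginal_def by (intro pmf_embed_pmf nn)
qed

definition mf_operator ::
  "nat \<Rightarrow> ('s, 'a::finite) reward \<Rightarrow> ('s, 'a) flow \<Rightarrow> ('s, 'a) flow"
where
  "mf_operator H r \<rho> h s a = (if h < H then - r s a (marginal \<rho> h) else 0)"

definition normal_cone ::
  "nat \<Rightarrow> ('s::finite, 'a::finite) flow set \<Rightarrow> ('s, 'a) flow \<Rightarrow> ('s, 'a) flow set"
where
  "normal_cone H K x =
     (if x \<in> K then {g \<in> flow_space H. \<forall>y\<in>K. flow_inner H g (y - x) \<le> 0} else {})"

end

theory Submission
  imports Defs
begin

text \<open>
  When the kernel does not see the population, every policy flow has an occupation flow that does not
  depend on the frozen population, and the objective is the inner product of the reward with that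
  flow.  Disintegrating with respect to the state marginal, the occupation flows of policy flows are
  exactly the points of the polytope.  Optimality of \<open>\<pi>\<close> against \<open>\<mu>\<close> thus says that its occupation
  flow maximises a linear functional over the polytope, which is the normal cone inclusion, while the
  consistency equation for \<open>\<mu>\<close> is membership in the polytope.
\<close>

lemma length_trajectory:
  "\<omega> \<in> set_pmf (trajectory P \<mu>0 \<pi> \<mu> n) \<Longrightarrow> length \<omega> = Suc n"
  by (induction n arbitrary: \<omega>) auto

lemma finite_set_trajectory:
  fixes P :: "('s::finite, 'a::finite) mf_kernel"
  shows "finite (set_pmf (trajectory P \<mu>0 \<pi> \<mu> n))"
  by (induction n) auto

text \<open>Markov property: appending a step leaves earlier entries alone, and the new entry
  depends on the past only through the last pair. The measure flow enters only through the kernel,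
  which ignores it.\<close>

lemma map_pmf_nth_trajectory:
  assumes "measure_independent P P0" and "h \<le> n"
  shows "map_pmf (\<lambda>\<omega>. \<omega> ! h) (trajectory P \<mu>0 \<pi> \<mu> n) =
    bind_pmf (state_flow P0 \<mu>0 \<pi> h) (\<lambda>s. map_pmf (Pair s) (\<pi> h s))"
  using \<open>h \<le> n\<close>
proof (induction n arbitrary: h)
  case 0
  then show ?case
    by (simp add: map_bind_pmf map_pmf_def bind_assoc_pmf bind_return_pmf)
next
  case (Suc n)
  let ?T = "trajectory P \<mu>0 \<pi> \<mu> n"
  let ?step = "\<lambda>(s, a). bind_pmf (P0 s a) (\<lambda>x. map_pmf (Pair x) (\<pi> (Suc n) x))"
  have P: "P s a \<nu> = P0 s a" for s a \<nu>
    using assms(1) by (simp add: measure_independent_def)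
  show ?case
  proof (cases "h \<le> n")
    case True
    have "map_pmf (\<lambda>\<omega>. \<omega> ! h) (trajectory P \<mu>0 \<pi> \<mu> (Suc n)) = bind_pmf ?T (\<lambda>\<omega>. return_pmf (\<omega> ! h))"
      unfolding trajectory.simps map_bind_pmf
      using True by (intro bind_pmf_cong refl) (simp add: nth_append length_trajectory)
    also have "\<dots> = map_pmf (\<lambda>\<omega>. \<omega> ! h) ?T"
      by (simp add: map_pmf_def)
    finally show ?thesis
      using Suc.IH[OF True] by simp
  next
    case False
    with Suc.prems have h: "h = Suc n" by simp
    have "map_pmf (\<lambda>\<omega>. \<omega> ! h) (trajectory P \<mu>0 \<pi> \<mu> (Suc n)) = bind_pmf ?T (\<lambda>\<omega>. ?step (\<omega> ! n))"
    proof -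
      \<comment> \<open>With \<open>last\<close> read as entry \<open>n\<close>, the step is a
        function of one entry, so the induction hypothesis applies at \<open>h = n\<close>.\<close>
      have "last \<omega> = \<omega> ! n" if "\<omega> \<in> set_pmf ?T" for \<omega>
        using length_trajectory[OF that] by (subst last_conv_nth) auto
      then show ?thesis
        unfolding h trajectory.simps map_bind_pmf P
        by (intro bind_pmf_cong refl) (simp add: nth_append length_trajectory split_beta map_pmf_def bind_return_pmf)
    qed
    also have "\<dots> = bind_pmf (map_pmf (\<lambda>\<omega>. \<omega> ! n) ?T) ?step"
      by (simp add: bind_map_pmf)
    also have "\<dots> = bind_pmf (state_flow P0 \<mu>0 \<pi> h) (\<lambda>s. map_pmf (Pair s) (\<pi> h s))"
      unfolding Suc.IH[OF order_refl] h by (simp add: bind_assoc_pmf bind_map_pmf)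
    finally show ?thesis .
  qed
qed

text \<open>Linearity of expectation splits the total reward over time, and each summand sees only
  the law of a single entry of the trajectory.\<close>

lemma objective_eq_flow_inner:
  fixes P :: "('s::finite, 'a::finite) mf_kernel"
  assumes "measure_independent P P0" and "H \<ge> 1"
  shows "objective H r P \<mu>0 \<pi> \<mu> =
    flow_inner H (\<lambda>h s a. r s a (\<mu> h)) (occupation H \<pi> (state_flow P0 \<mu>0 \<pi>))"
proof -
  let ?T = "trajectory P \<mu>0 \<pi> \<mu> (H - 1)"
  have "measure_pmf.expectation ?T (\<lambda>\<omega>. r (fst (\<omega> ! h)) (snd (\<omega> ! h)) (\<mu> h)) =
      (\<Sum>s\<in>UNIV. \<Sum>a\<in>UNIV. r s a (\<mu> h) * occupation H \<pi> (state_flow P0 \<mu>0 \<pi>) h s a)"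
    if "h < H" for h
  proof -
    let ?D = "bind_pmf (state_flow P0 \<mu>0 \<pi> h) (\<lambda>s. map_pmf (Pair s) (\<pi> h s))"
    have pmf_D: "pmf ?D (s, a) = pmf (\<pi> h s) a * pmf (state_flow P0 \<mu>0 \<pi> h) s" for s a
    proof -
      have pair: "pmf (map_pmf (Pair t) (\<pi> h t)) (s, a) = (if t = s then pmf (\<pi> h s) a else 0)" for t
        by (auto simp: pmf_map_inj' inj_on_def pmf_eq_0_set_pmf)
      show ?thesis
        by (simp add: pmf_bind integral_measure_pmf[of UNIV] pair if_distrib[of "\<lambda>x. _ * x"] cong: if_cong)
    qed
    have "measure_pmf.expectation ?T (\<lambda>\<omega>. r (fst (\<omega> ! h)) (snd (\<omega> ! h)) (\<mu> h)) =
        measure_pmf.expectation (map_pmf (\<lambda>\<omega>. \<omega> ! h) ?T) (\<lambda>z. r (fst z) (snd z) (\<mu> h))"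
      by simp
    also have "\<dots> = measure_pmf.expectation ?D (\<lambda>z. r (fst z) (snd z) (\<mu> h))"
      using map_pmf_nth_trajectory[OF assms(1), of h "H - 1"] that by simp
    also have "\<dots> = (\<Sum>z\<in>UNIV \<times> UNIV. pmf ?D z * r (fst z) (snd z) (\<mu> h))"
      by (subst integral_measure_pmf[of UNIV]) simp_all
    also have "\<dots> = (\<Sum>s\<in>UNIV. \<Sum>a\<in>UNIV. pmf ?D (s, a) * r s a (\<mu> h))"
      by (subst sum.cartesian_product) (simp add: split_beta)
    finally show ?thesis
      using that by (simp add: pmf_D occupation_def mult_ac)
  qed
  then show ?thesis
    unfolding objective_def flow_inner_def
    by (subst Bochner_Integration.integral_sum)
      (auto intro!: integrable_measure_pmf_finite finite_set_trajectory)
qed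

lemma sum_occupation:
  "h < H \<Longrightarrow> (\<Sum>a\<in>UNIV. occupation H \<pi> \<mu> h s (a::'a::finite)) = pmf (\<mu> h) s"
  by (simp add: occupation_def sum_distrib_right[symmetric] sum_pmf_eq_1)

text \<open>Summing over actions turns \<open>occupation\<close> back into \<open>\<mu> h\<close>,
  so the marginal constraints become the initial condition and the forward equation.\<close>

lemma occupation_mem_polytope_iff:
  fixes P0 :: "('s::finite, 'a::finite) kernel"
  assumes "H \<ge> 1"
  shows "occupation H \<pi> \<mu> \<in> occupation_polytope H P0 \<mu>0 \<longleftrightarrow>
    \<mu> 0 = \<mu>0 \<and> (\<forall>h. Suc h < H \<longrightarrow> (\<forall>s'. pmf (\<mu> (Suc h)) s' =
      (\<Sum>s\<in>UNIV. \<Sum>a\<in>UNIV. pmf (P0 s a) s' * pmf (\<pi> h s) a * pmf (\<mu> h) s)))"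
proof -
  have "occupation H \<pi> \<mu> \<in> flow_space H" "0 \<le> occupation H \<pi> \<mu> h s a" for h s a
    by (simp_all add: flow_space_def occupation_def)
  moreover have "(\<Sum>s\<in>UNIV. \<Sum>a\<in>UNIV. pmf (P0 s a) s' * occupation H \<pi> \<mu> h s a) =
      (\<Sum>s\<in>UNIV. \<Sum>a\<in>UNIV. pmf (P0 s a) s' * pmf (\<pi> h s) a * pmf (\<mu> h) s)" if "Suc h < H" for h s'
    using that by (simp add: occupation_def mult.assoc)
  ultimately show ?thesis
    using assms by (auto simp: occupation_polytope_def sum_occupation pmf_eq_iff)
qed

lemma occupation_state_flow_mem_polytope:
  fixes P0 :: "('s::finite, 'a::finite) kernel"
  assumes "H \<ge> 1"
  shows "occupation H \<pi> (state_flow P0 \<mu>0 \<pi>) \<in> occupation_polytope H P0 \<mu>0"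
  by (simp add: occupation_mem_polytope_iff[OF assms] pmf_state_flow_Suc del: state_flow.simps(2))

text \<open>Below \<open>H\<close> the polytope constraints give \<open>\<mu>\<close> the same start
  and recursion as \<open>state_flow\<close>; they say nothing about later indices.\<close>

lemma state_flow_eqI:
  fixes P0 :: "('s::finite, 'a::finite) kernel"
  assumes "occupation H \<pi> \<mu> \<in> occupation_polytope H P0 \<mu>0" and "h < H"
  shows "\<mu> h = state_flow P0 \<mu>0 \<pi> h"
proof -
  have "H \<ge> 1"
    using assms(2) by simp
  note consistent = assms(1)[unfolded occupation_mem_polytope_iff[OF this]]
  show ?thesis
    using \<open>h < H\<close>
  proof (induction h)
    case 0
    then show ?case
      using consistent by simp
  next
    case (Suc h)
    then show ?case
      using consistent by (intro pmf_eqI) (simp add: pmf_state_flow_Suc del: state_flow.simps(2))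
  qed
qed

text \<open>\<open>\<kappa> s\<close> is the conditional law of the action given \<open>s\<close>.
  The product form, without a quotient, also covers states of mass zero.\<close>

lemma disintegrate_finite:
  fixes f :: "'s \<Rightarrow> 'a::finite \<Rightarrow> real"
  assumes nn: "\<And>s a. 0 \<le> f s a"
  shows "\<exists>\<kappa>. \<forall>s a. f s a = pmf (\<kappa> s) a * (\<Sum>b\<in>UNIV. f s b)"
proof -
  have "\<exists>p. \<forall>a. f s a = pmf p a * (\<Sum>b\<in>UNIV. f s b)" for s
  proof (cases "(\<Sum>b\<in>UNIV. f s b) = 0")
    \<comment> \<open>By nonnegativity every \<open>f s a\<close> vanishes, so any \<open>p\<close>
      serves.\<close>
    case True
    then show ?thesis
      using nn by (simp add: sum_nonneg_eq_0_iff)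
  next
    case False
    let ?m = "\<Sum>b\<in>UNIV. f s b"
    have "0 \<le> ?m"
      using nn by (intro sum_nonneg) simp
    then have nn': "0 \<le> f s a / ?m" for a
      using nn by simp
    have "(\<integral>\<^sup>+ a. ennreal (f s a / ?m) \<partial>count_space UNIV) = 1"
      using nn' False
      by (simp add: nn_integral_count_space_finite sum_ennreal sum_divide_distrib[symmetric])
    then have "pmf (embed_pmf (\<lambda>a. f s a / ?m)) a = f s a / ?m" for a
      by (intro pmf_embed_pmf nn')
    with False show ?thesis
      by (intro exI[of _ "embed_pmf (\<lambda>a. f s a / ?m)"]) simp
  qed
  then show ?thesis
    by metis
qed

text \<open>This turns a maximum over policy flows into one over a polytope, on which the objective
  is linear.\<close>

lemma occupation_polytope_eq_range:
  fixes P0 :: "('s::finite, 'a::finite) kernel"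
  assumes "H \<ge> 1"
  shows "occupation_polytope H P0 \<mu>0 = range (\<lambda>\<pi>. occupation H \<pi> (state_flow P0 \<mu>0 \<pi>))"
proof (intro equalityI subsetI)
  fix \<rho> assume \<rho>: "\<rho> \<in> occupation_polytope H P0 \<mu>0"
  have "0 \<le> \<rho> h s a" if "h < H" for h s a
    using \<rho> that by (simp add: occupation_polytope_def)
  \<comment> \<open>The guard lets a kernel be chosen at every \<open>h\<close>; past the horizon
    any kernel will do, since \<open>occupation\<close> is 0 there.\<close>
  then have "\<exists>\<kappa>. h < H \<longrightarrow> (\<forall>s a. \<rho> h s a = pmf (\<kappa> s) a * (\<Sum>b\<in>UNIV. \<rho> h s b))" for h
    using disintegrate_finite[of "\<rho> h"] by blast
  then obtain \<pi> where \<pi>: "h < H \<Longrightarrow> \<rho> h s a = pmf (\<pi> h s) a * (\<Sum>b\<in>UNIV. \<rho> h s b)" for h s a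
    by metis
  have occ: "\<rho> = occupation H \<pi> (marginal \<rho>)"
  proof (intro ext)
    fix h s a
    show "\<rho> h s a = occupation H \<pi> (marginal \<rho>) h s a"
    proof (cases "h < H")
      case True
      then show ?thesis
        using \<pi>[OF True, of s a] by (simp only: occupation_def pmf_marginal[OF \<rho>] if_True)
    next
      case False
      then show ?thesis
        using \<rho> by (simp add: occupation_def occupation_polytope_def flow_space_def)
    qed
  qed
  have "occupation H \<pi> (marginal \<rho>) \<in> occupation_polytope H P0 \<mu>0"
    using \<rho> by (simp only: occ[symmetric])
  \<comment> \<open>The rebuilt policy generates the marginals of \<open>\<rho>\<close> below
    \<open>H\<close>, the only indices that \<open>occupation\<close> reads.\<close>
  from state_flow_eqI[OF this]
  have "occupation H \<pi> (marginal \<rho>) = occupation H \<pi> (state_flow P0 \<mu>0 \<pi>)"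
    by (intro ext) (simp add: occupation_def)
  with occ show "\<rho> \<in> range (\<lambda>\<pi>. occupation H \<pi> (state_flow P0 \<mu>0 \<pi>))"
    by (metis rangeI)
qed (auto simp: occupation_state_flow_mem_polytope[OF assms])

text \<open>Ensures that the operator at such an occupation flow evaluates the reward at the given
  population \<open>\<mu> h\<close>.\<close>

lemma marginal_occupation:
  fixes P0 :: "('s::finite, 'a::finite) kernel"
  assumes "occupation H \<pi> \<mu> \<in> occupation_polytope H P0 \<mu>0" and "h < H"
  shows "marginal (occupation H \<pi> \<mu>) h = \<mu> h"
  by (intro pmf_eqI) (simp add: pmf_marginal[OF assms] sum_occupation assms(2))

lemma flow_inner_diff_right:
  "flow_inner H f (g - g') = flow_inner H f g - flow_inner H f g'"
  by (simp add: flow_inner_def right_diff_distrib sum_subtractf)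

theorem corollary1:
  fixes H :: nat
    and r :: "('s::finite, 'a::finite) reward"
    and P :: "('s, 'a) mf_kernel"
    and P0 :: "('s, 'a) kernel"
    and \<mu>0 :: "'s pmf"
    and L\<^sub>r :: real
    and \<pi>' :: "('s, 'a) policy_flow"
    and \<mu>' :: "'s measure_flow"
    and \<rho>' :: "('s, 'a) flow"
  assumes "H \<ge> 1"
    and "measure_independent P P0"
    and "weakly_monotone H r P0 \<mu>0"
    and "lipschitz_reward L\<^sub>r r"
    and "\<mu>' 0 = \<mu>0"
    and "\<rho>' = occupation H \<pi>' \<mu>'"
  shows "mean_field_equilibrium H r P \<mu>0 \<pi>' \<mu>' \<longleftrightarrow>
    \<rho>' \<in> occupation_polytope H P0 \<mu>0 \<and>
    0 \<in> mf_operator H r \<rho>' +o normal_cone H (occupation_polytope H P0 \<mu>0) \<rho>'"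
proof -
  let ?K = "occupation_polytope H P0 \<mu>0"
  let ?R = "\<lambda>h s a. r s a (\<mu>' h)"
  have consistent: "\<rho>' \<in> ?K \<longleftrightarrow> (\<forall>h. Suc h < H \<longrightarrow> (\<forall>s'. pmf (\<mu>' (Suc h)) s' =
      (\<Sum>s\<in>UNIV. \<Sum>a\<in>UNIV. pmf (P s a (\<mu>' h)) s' * pmf (\<pi>' h s) a * pmf (\<mu>' h) s)))"
    using assms(2,5,6) occupation_mem_polytope_iff[OF \<open>H \<ge> 1\<close>, of \<pi>' \<mu>' P0 \<mu>0]
    by (simp add: measure_independent_def)
  \<comment> \<open>Membership of \<open>\<rho>'\<close> may be assumed here, since by
    \<open>consistent\<close> both sides of the claim contain it as a conjunct.\<close>
  have "(\<forall>\<pi>. objective H r P \<mu>0 \<pi> \<mu>' \<le> objective H r P \<mu>0 \<pi>' \<mu>') \<longleftrightarrow>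
      0 \<in> mf_operator H r \<rho>' +o normal_cone H ?K \<rho>'" if \<rho>': "\<rho>' \<in> ?K"
  proof -
    have occ: "occupation H \<pi>' (state_flow P0 \<mu>0 \<pi>') = \<rho>'"
      using state_flow_eqI[of H \<pi>' \<mu>' P0 \<mu>0] \<rho>' assms(6)
      by (intro ext) (simp add: occupation_def)
    \<comment> \<open>The inclusion has a single candidate for the normal vector.\<close>
    have neg: "(0 = mf_operator H r \<rho>' + g) \<longleftrightarrow> g = - mf_operator H r \<rho>'" for g
      by (metis add.commute eq_neg_iff_add_eq_0)
    \<comment> \<open>The operator is frozen at \<open>\<rho>'\<close>, so the functional is linear
      in \<open>y\<close>, with the reward at \<open>\<mu>'\<close> as coefficients.\<close>
    have inner: "flow_inner H (- mf_operator H r \<rho>') y = flow_inner H ?R y" for y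
      using marginal_occupation[of H \<pi>' \<mu>' P0 \<mu>0] \<rho>' assms(6)
      by (simp add: flow_inner_def mf_operator_def)
    have "- mf_operator H r \<rho>' \<in> flow_space H"
      by (simp add: flow_space_def mf_operator_def)
    then have "0 \<in> mf_operator H r \<rho>' +o normal_cone H ?K \<rho>' \<longleftrightarrow>
        (\<forall>y\<in>?K. flow_inner H ?R y \<le> flow_inner H ?R \<rho>')"
      using \<rho>' by (simp add: elt_set_plus_def neg normal_cone_def inner flow_inner_diff_right)
    \<comment> \<open>Letting \<open>y\<close> run over the polytope is letting \<open>\<pi>\<close>
      run over all policy flows, and \<open>\<pi>'\<close> itself yields
      \<open>\<rho>'\<close>.\<close>
    then show ?thesis
      by (simp add: objective_eq_flow_inner[OF assms(2,1)] occ occupation_polytope_eq_range[OF assms(1)])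
  qed
  with consistent show ?thesis
    unfolding mean_field_equilibrium_def by blast
qed

end
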